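(* Let $Q$ be a polytope and $\mathcal{O}$ a facial orientation of its 1-skeleton such that $Q$ is $\mathcal{O}$-directionally simple and $\mathcal{O}$ is the Hasse diagram of a lattice $L=P(Q,\mathcal{O})$. Let $u\in L$ and suppose $u\lessdot a_1,\ldots,a_r$ (distinct upper covers of $u$). Then $a_1\vee\cdots\vee a_r=\mathrm{psj}(a_1,\ldots,a_r)$.
   Context: An acyclic orientation $\mathcal{O}$ of the 1-skeleton of a polytope $Q$ is a facial orientation if its restriction to every face $F$ of $Q$ has a unique source and a unique sink $\mathrm{sink}(F)$. The 1-skeleton poset $P(Q,\mathcal{O})$ is the transitive closure of $\mathcal{O}$ on the vertices of $Q$; "$\mathcal{O}$ is the Hasse diagram of $L$" means its directed edges are exactly the cover relations of $L$. $Q$ is $\mathcal{O}$-directionally simple if for every vertex $x$ and every subset $E$ of the edges directed out of $x$, there is a distinct face $F_E$ of $Q$ of dimension $|E|$ containing $x$ and the edges of $E$. For a set $S$ of upper covers of $u$, the pseudojoin $\mathrm{psj}(S)$ is $\mathrm{sink}(F_S)$, where $F_S$ is the unique $|S|$-dimensional face containing $u$ and the elements of $S$. *)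

theory Defs
  imports "HOL-Analysis.Analysis" "HOL-Algebra.Lattice"
begin

definition vertices :: "'a::euclidean_space set \<Rightarrow> 'a set"
  where "vertices Q = {x. x extreme_point_of Q}"

text \<open>The 1-skeleton as a symmetric relation on the vertices.\<close>

definition skeleton :: "'a::euclidean_space set \<Rightarrow> ('a \<times> 'a) set"
  where "skeleton Q = {(x, y). x \<in> vertices Q \<and> y \<in> vertices Q \<and> closed_segment x y edge_of Q}"

definition is_orientation :: "'a::euclidean_space set \<Rightarrow> ('a \<times> 'a) set \<Rightarrow> bool"
  where "is_orientation Q \<O> \<longleftrightarrow> \<O> \<union> \<O>\<inverse> = skeleton Q \<and> \<O> \<inter> \<O>\<inverse> = {}"

text \<open>
  The vertices of a face \<open>F\<close> of \<open>Q\<close> are the vertices of \<open>Q\<close> lying in \<open>F\<close>, and the edges of \<open>F\<close>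
  are the edges of \<open>Q\<close> with both endpoints in \<open>F\<close>; hence the restriction of an orientation to \<open>F\<close>
  is its restriction to \<open>vertices F\<close>.
\<close>

definition face_orientation :: "('a \<times> 'a) set \<Rightarrow> 'a::euclidean_space set \<Rightarrow> ('a \<times> 'a) set"
  where "face_orientation \<O> F = \<O> \<inter> (vertices F \<times> vertices F)"

definition is_source :: "('a \<times> 'a) set \<Rightarrow> 'a::euclidean_space set \<Rightarrow> 'a \<Rightarrow> bool"
  where "is_source \<O> F x \<longleftrightarrow> x \<in> vertices F \<and> (\<forall>y. (y, x) \<notin> face_orientation \<O> F)"

definition is_sink :: "('a \<times> 'a) set \<Rightarrow> 'a::euclidean_space set \<Rightarrow> 'a \<Rightarrow> bool"
  where "is_sink \<O> F x \<longleftrightarrow> x \<in> vertices F \<and> (\<forall>y. (x, y) \<notin> face_orientation \<O> F)"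

definition facial_orientation :: "'a::euclidean_space set \<Rightarrow> ('a \<times> 'a) set \<Rightarrow> bool"
  where "facial_orientation Q \<O> \<longleftrightarrow> is_orientation Q \<O> \<and> acyclic \<O> \<and>
    (\<forall>F. F face_of Q \<and> F \<noteq> {} \<longrightarrow> (\<exists>!x. is_source \<O> F x) \<and> (\<exists>!x. is_sink \<O> F x))"

definition sink :: "('a \<times> 'a) set \<Rightarrow> 'a::euclidean_space set \<Rightarrow> 'a"
  where "sink \<O> F = (THE x. is_sink \<O> F x)"

definition skeleton_poset :: "'a::euclidean_space set \<Rightarrow> ('a \<times> 'a) set \<Rightarrow> 'a gorder"
  where "skeleton_poset Q \<O> = \<lparr>carrier = vertices Q, eq = (=), le = (\<lambda>x y. (x, y) \<in> \<O>\<^sup>*)\<rparr>"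

definition is_covered_by :: "('a, 'c) gorder_scheme \<Rightarrow> 'a \<Rightarrow> 'a \<Rightarrow> bool"
  where "is_covered_by L x y \<longleftrightarrow> x \<in> carrier L \<and> y \<in> carrier L \<and> x \<sqsubset>\<^bsub>L\<^esub> y \<and>
    \<not> (\<exists>z \<in> carrier L. x \<sqsubset>\<^bsub>L\<^esub> z \<and> z \<sqsubset>\<^bsub>L\<^esub> y)"

definition is_Hasse_diagram_of :: "('a \<times> 'a) set \<Rightarrow> ('a, 'c) gorder_scheme \<Rightarrow> bool"
  where "is_Hasse_diagram_of \<O> L \<longleftrightarrow> \<O> = {(x, y). is_covered_by L x y}"

definition out_edges :: "('a \<times> 'a) set \<Rightarrow> 'a \<Rightarrow> ('a \<times> 'a) set"
  where "out_edges \<O> x = {e \<in> \<O>. fst e = x}"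

text \<open>
  Distinctness of the faces \<open>F\<^sub>E\<close> is injectivity of \<open>E \<mapsto> F\<^sub>E\<close>. It makes \<open>F\<^sub>E\<close> the only face of
  dimension \<open>card E\<close> containing \<open>x\<close> and the edges in \<open>E\<close>.
\<close>

definition directionally_simple :: "'a::euclidean_space set \<Rightarrow> ('a \<times> 'a) set \<Rightarrow> bool"
  where "directionally_simple Q \<O> \<longleftrightarrow>
    (\<forall>x \<in> vertices Q. \<exists>F. inj_on F (Pow (out_edges \<O> x)) \<and>
      (\<forall>E. E \<subseteq> out_edges \<O> x \<longrightarrow>
        F E face_of Q \<and> aff_dim (F E) = int (card E) \<and> x \<in> F E \<and>
        (\<forall>(y, z) \<in> E. closed_segment y z \<subseteq> F E)))"

definition pseudojoin :: "'a::euclidean_space set \<Rightarrow> ('a \<times> 'a) set \<Rightarrow> 'a \<Rightarrow> 'a set \<Rightarrow> 'a"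
  where "pseudojoin Q \<O> u S =
    sink \<O> (THE F. F face_of Q \<and> aff_dim F = int (card S) \<and> u \<in> F \<and> S \<subseteq> F)"

end

theory Submission
  imports Defs
begin

text \<open>
  Each polygon spanned by two arcs out of \<open>x\<close> has the join of their endpoints as its sink, by downward
  induction on \<open>x\<close>: given the claim above \<open>x\<close>, order intervals ending in the sink of the polygon stay
  inside it, so the join is a vertex of the polygon that is entered by two different arcs.

  For the general case let \<open>v\<close> bound the upper covers \<open>S\<close> of \<open>u\<close>, and suppose the sink of \<open>F\<^sub>S\<close> is not
  below \<open>v\<close>. Then some arc of \<open>F\<^sub>S\<close> leaves the down-set of \<open>v\<close>; take one with a minimal starting point
  \<open>x\<close>. If \<open>x \<noteq> u\<close>, then \<open>x\<close> is not the source of \<open>F\<^sub>S\<close>, so the arc lies on a polygon whose source is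
  strictly below \<open>x\<close>. By minimality both arcs at that source stay below \<open>v\<close>, hence so does the sink of
  the polygon, a contradiction. If \<open>x = u\<close>, the arc ends in \<open>S\<close>, which is below \<open>v\<close>.
\<close>

section \<open>Edges at a vertex of a polytope\<close>

lemma face_of_eq_if_aff_dim_le:
  fixes S :: "'a::euclidean_space set"
  assumes "convex S" "T face_of S" "aff_dim S \<le> aff_dim T"
  shows "T = S"
  using face_of_aff_dim_lt[OF assms(1,2)] assms(3) by force

lemma vertices_face:
  assumes "F face_of Q"
  shows "vertices F = vertices Q \<inter> F"
  using extreme_point_of_face[OF assms] by (auto simp: vertices_def)

lemma vertices_subset: "vertices Q \<subseteq> Q"
  by (auto simp: vertices_def extreme_point_of_def)

lemma finite_vertices: "polytope Q \<Longrightarrow> finite (vertices Q)"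
  unfolding vertices_def
  by (rule finite_polyhedron_extreme_points) (rule polytope_imp_polyhedron)

lemma skeleton_face:
  assumes "F face_of Q"
  shows "skeleton F = skeleton Q \<inter> (vertices F \<times> vertices F)"
proof -
  have "closed_segment x y face_of F \<longleftrightarrow> closed_segment x y face_of Q"
    if "x \<in> vertices F" "y \<in> vertices F" for x y
  proof -
    have "convex F"
      using assms by (simp add: face_of_def)
    then have "closed_segment x y \<subseteq> F"
      using that vertices_subset by (meson closed_segment_subset subsetD)
    then show ?thesis
      using face_of_face[OF assms] by blast
  qed
  then show ?thesis
    by (auto simp: skeleton_def edge_of_def vertices_face[OF assms])
qed

lemma skeleton_edge_subset_face:
  assumes "F face_of Q" "(x, y) \<in> skeleton Q" "x \<in> F" "y \<in> F"
  shows "(x, y) \<in> skeleton F"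
proof -
  have "x \<in> vertices Q" "y \<in> vertices Q"
    using assms(2) by (auto simp: skeleton_def)
  then show ?thesis
    using assms by (simp add: skeleton_face vertices_face)
qed

lemma skeleton_neq: "(x, y) \<in> skeleton Q \<Longrightarrow> x \<noteq> y"
  by (auto simp: skeleton_def edge_of_def)

lemma skeleton_sym: "(x, y) \<in> skeleton Q \<Longrightarrow> (y, x) \<in> skeleton Q"
  by (auto simp: skeleton_def closed_segment_commute)

lemma vertex_in_skeleton_edge:
  assumes "(x, y) \<in> skeleton Q" "z \<in> vertices Q" "z \<in> closed_segment x y"
  shows "z = x \<or> z = y"
  using assms extreme_point_of_face[of "closed_segment x y" Q z]
  by (simp add: skeleton_def edge_of_def vertices_def extreme_point_of_segment)

text \<open>A proper nonempty face is the intersection of the facets containing it, and a single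
  facet has too large a dimension to be that intersection.\<close>

lemma two_facets_containing_face:
  fixes K :: "'a::euclidean_space set"
  assumes "polytope K" "T face_of K" "T \<noteq> {}" "aff_dim T + 2 \<le> aff_dim K"
  obtains H1 H2 where "H1 facet_of K" "H2 facet_of K" "T \<subseteq> H1" "T \<subseteq> H2" "H1 \<noteq> H2"
proof -
  let ?A = "{F. F facet_of K \<and> T \<subseteq> F}"
  have "T \<noteq> K"
    using assms(4) by auto
  then have T: "T = \<Inter>?A"
    using face_of_polyhedron[OF polytope_imp_polyhedron[OF assms(1)] assms(2,3)] by simp
  have "?A \<noteq> {}"
  proof
    assume "?A = {}"
    then have "T = UNIV"
      using T by auto
    then show False
      using \<open>T \<noteq> K\<close> face_of_imp_subset[OF assms(2)] by auto
  qed
  then obtain H1 where H1: "H1 \<in> ?A"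
    by blast
  have "?A \<noteq> {H1}"
  proof
    assume "?A = {H1}"
    then have "T = H1"
      using T by auto
    then show False
      using H1 assms(4) by (simp add: facet_of_def)
  qed
  then obtain H2 where "H2 \<in> ?A" "H2 \<noteq> H1"
    using H1 by blast
  then show thesis
    using H1 that by blast
qed

text \<open>A vertex of a polytope of dimension at least two lies on two facets, whose affine hulls differ.\<close>

lemma aff_dim_le_vertex_neighbours:
  fixes K :: "'a::euclidean_space set"
  assumes "polytope K" "x \<in> vertices K"
  shows "aff_dim K \<le> aff_dim (insert x (skeleton K `` {x}))"
  using assms
proof (induction "nat (aff_dim K)" arbitrary: K rule: less_induct)
  case less
  let ?W = "insert x (skeleton K `` {x})"
  have convex: "convex K"
    using less.prems(1) polytope_imp_convex by blast
  have x: "x \<in> K" "{x} face_of K"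
    using less.prems(2) vertices_subset by (auto simp: vertices_def face_of_singleton)
  consider "aff_dim K \<le> 0" | "aff_dim K = 1" | "aff_dim K \<ge> 2"
    by linarith
  then show ?case
  proof cases
    case 1
    then show ?thesis
      using aff_dim_subset[of "{x}" ?W] by simp
  next
    case 2
    then have "collinear K"
      by (simp add: collinear_aff_dim)
    then obtain p q where pq: "K = closed_segment p q"
      using compact_convex_collinear_segment[of K] x(1) convex less.prems(1) polytope_imp_compact
      by blast
    have "p \<noteq> q"
      using 2 pq by auto
    have "x = p \<or> x = q"
      using less.prems(2) pq by (simp add: vertices_def extreme_point_of_segment)
    then obtain y where y: "K = closed_segment x y" "x \<noteq> y"
      using pq \<open>p \<noteq> q\<close> closed_segment_commute by metis
    then have "(x, y) \<in> skeleton K"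
      using 2 convex by (simp add: skeleton_def vertices_def extreme_point_of_segment edge_of_def
          face_of_refl)
    then have "aff_dim {x, y} \<le> aff_dim ?W"
      by (intro aff_dim_subset) auto
    then show ?thesis
      using 2 y(2) by (simp add: aff_dim_2)
  next
    case 3
    obtain H1 H2 where H: "H1 facet_of K" "H2 facet_of K" "{x} \<subseteq> H1" "{x} \<subseteq> H2" "H1 \<noteq> H2"
      using two_facets_containing_face[OF less.prems(1) x(2)] 3 by auto
    \<comment> \<open>By induction \<open>x\<close> and its neighbours within \<open>H\<close>
      already span the affine hull of \<open>H\<close>. If the dimension of \<open>?W\<close> is
      below that of \<open>K\<close>, there is no room for \<open>?W\<close> beyond this
      hull.\<close>
    have hull: "affine hull H = affine hull ?W"
      if H: "H facet_of K" "x \<in> H" and W: "aff_dim ?W < aff_dim K" for H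
    proof -
      let ?V = "insert x (skeleton H `` {x})"
      have HK: "H face_of K" and dim: "aff_dim H = aff_dim K - 1"
        using H by (auto simp: facet_of_def)
      have "?V \<subseteq> H" "?V \<subseteq> ?W"
        using H(2) vertices_subset by (auto simp: skeleton_face[OF HK])
      moreover have "aff_dim H \<le> aff_dim ?V"
      proof (rule less.hyps)
        show "nat (aff_dim H) < nat (aff_dim K)"
          using dim 3 by linarith
        show "polytope H"
          using less.prems(1) HK face_of_polytope_polytope by blast
        show "x \<in> vertices H"
          using less.prems(2) H(2) by (simp add: vertices_face[OF HK])
      qed
      ultimately have "aff_dim ?V = aff_dim H" "aff_dim ?V = aff_dim ?W"
        using W dim aff_dim_subset[of ?V H] aff_dim_subset[of ?V ?W] by linarith+
      then have "affine hull ?V = affine hull H" "affine hull ?V = affine hull ?W"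
        using aff_dim_eq_full_gen \<open>?V \<subseteq> H\<close> \<open>?V \<subseteq> ?W\<close> by blast+
      then show ?thesis
        by simp
    qed
    show ?thesis
    proof (rule ccontr)
      assume "\<not> ?thesis"
      then have "affine hull H1 = affine hull H2"
        using hull[of H1] hull[of H2] H by simp
      \<comment> \<open>A face is the intersection of the polytope with its affine hull, so the two
        facets would be equal.\<close>
      then show False
        using face_of_imp_eq_affine_Int[OF convex, of H1] face_of_imp_eq_affine_Int[OF convex, of H2]
          H by (auto simp: facet_of_def)
    qed
  qed
qed

text \<open>
  The functionals exposing the faces that omit one \<open>e \<in> E\<close> are dual to the vectors \<open>e - x\<close> up to
  sign and scaling. So these vectors form a basis, and \<open>K\<close> lies in the cone with apex \<open>x\<close> that they
  generate.
\<close>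

lemma edges_at_simple_vertex:
  fixes K :: "'a::euclidean_space set"
  assumes K: "polytope K" and xp: "(x, p) \<in> skeleton K"
    and E: "finite E" "E \<subseteq> vertices K" "aff_dim K = int (card E)"
    and facets: "\<And>e. e \<in> E \<Longrightarrow> \<exists>H. H face_of K \<and> x \<in> H \<and> E - {e} \<subseteq> H \<and> e \<notin> H"
  shows "p \<in> E"
proof -
  have x: "x \<in> K" and p: "p \<in> K"
    using xp vertices_subset by (auto simp: skeleton_def)
  have EK: "E \<subseteq> K"
    using E(2) vertices_subset by blast
  have "\<exists>a. (\<forall>y\<in>K. a \<bullet> (y - x) \<le> 0) \<and> (\<forall>e'\<in>E - {e}. a \<bullet> (e' - x) = 0) \<and> a \<bullet> (e - x) < 0"
    if e: "e \<in> E" for e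
  proof -
    obtain H where H: "H face_of K" "x \<in> H" "E - {e} \<subseteq> H" "e \<notin> H"
      using facets[OF e] by blast
    then obtain a b where ab: "K \<subseteq> {x. a \<bullet> x \<le> b}" "H = K \<inter> {x. a \<bullet> x = b}"
      using exposed_face_of_polyhedron[OF polytope_imp_polyhedron[OF K]]
      unfolding exposed_face_of_def by metis
    have "\<forall>y\<in>K. a \<bullet> (y - x) \<le> 0" "\<forall>e'\<in>E - {e}. a \<bullet> (e' - x) = 0"
      using ab H by (auto simp: inner_diff_right)
    moreover have "e \<in> K" "a \<bullet> e \<noteq> b" "a \<bullet> x = b"
      using H ab e EK by auto
    then have "a \<bullet> (e - x) < 0"
      using ab by (auto simp: inner_diff_right)
    ultimately show ?thesis
      by blast
  qed
  then obtain a where a: "\<And>e y. e \<in> E \<Longrightarrow> y \<in> K \<Longrightarrow> a e \<bullet> (y - x) \<le> 0"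
    "\<And>e e'. e \<in> E \<Longrightarrow> e' \<in> E \<Longrightarrow> e' \<noteq> e \<Longrightarrow> a e \<bullet> (e' - x) = 0"
    "\<And>e. e \<in> E \<Longrightarrow> a e \<bullet> (e - x) < 0"
    by (metis Diff_iff singletonD)
  have a_sum: "a e \<bullet> (\<Sum>e'\<in>E. c e' *\<^sub>R (e' - x)) = c e * (a e \<bullet> (e - x))" if "e \<in> E" for e c
  proof -
    have "a e \<bullet> (\<Sum>e'\<in>E. c e' *\<^sub>R (e' - x)) = (\<Sum>e'\<in>E. c e' * (a e \<bullet> (e' - x)))"
      by (simp add: inner_sum_right)
    also have "\<dots> = (\<Sum>e'\<in>E. if e' = e then c e * (a e \<bullet> (e - x)) else 0)"
      using a(2) that by (intro sum.cong) auto
    also have "\<dots> = c e * (a e \<bullet> (e - x))"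
      using that E(1) by simp
    finally show ?thesis .
  qed
  define B where "B = (\<lambda>e. e - x) ` E"
  have inj: "inj_on (\<lambda>e. e - x) E"
    by (simp add: inj_on_def)
  have "independent B"
  proof (rule independent_if_scalars_zero)
    show "finite B"
      using E(1) by (simp add: B_def)
  next
    fix f v
    assume f: "(\<Sum>v\<in>B. f v *\<^sub>R v) = 0" and "v \<in> B"
    then obtain e where e: "e \<in> E" "v = e - x"
      by (auto simp: B_def)
    have "(\<Sum>e\<in>E. f (e - x) *\<^sub>R (e - x)) = 0"
      using f by (simp add: B_def sum.reindex[OF inj])
    then have "f (e - x) * (a e \<bullet> (e - x)) = 0"
      using a_sum[OF e(1), of "\<lambda>e. f (e - x)"] by simp
    then show "f v = 0"
      using a(3)[OF e(1)] e by auto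
  qed
  moreover have "B \<subseteq> (\<lambda>y. y - x) ` K"
    using EK by (auto simp: B_def)
  moreover have "dim ((\<lambda>y. y - x) ` K) \<le> card B"
    using E(3) aff_dim_eq_dim_subtract[of x K] x inj by (simp add: B_def hull_inc card_image)
  ultimately have "(\<lambda>y. y - x) ` K \<subseteq> span B"
    by (intro card_ge_dim_independent)
  then have "p - x \<in> range (\<lambda>u. \<Sum>v\<in>B. u v *\<^sub>R v)"
    using p E(1) by (auto simp: B_def span_finite[symmetric])
  then obtain f where "p - x = (\<Sum>v\<in>B. f v *\<^sub>R v)"
    by auto
  then have px: "p - x = (\<Sum>e\<in>E. f (e - x) *\<^sub>R (e - x))"
    by (simp add: B_def sum.reindex[OF inj])
  have f_nonneg: "f (e - x) \<ge> 0" if "e \<in> E" for e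
  proof -
    have "f (e - x) * (a e \<bullet> (e - x)) \<le> 0"
      using a(1)[OF that p] a_sum[OF that, of "\<lambda>e. f (e - x)"] px by simp
    then show ?thesis
      using a(3)[OF that] by (simp add: mult_le_0_iff)
  qed
  have "p \<noteq> x"
    using xp skeleton_neq by blast
  then obtain e where e: "e \<in> E" "f (e - x) \<noteq> 0"
    using px by (metis (no_types, lifting) eq_iff_diff_eq_0 scaleR_eq_0_iff sum.neutral)
  \<comment> \<open>The functional \<open>g\<close> exposes the edge from \<open>x\<close> to
    \<open>p\<close>. Applied to the expansion of \<open>p - x\<close> it yields nonnegative terms
    with sum 0, so an \<open>e\<close> with nonzero coefficient lies on that edge.\<close>
  obtain g b where gb: "K \<subseteq> {x. g \<bullet> x \<le> b}" "closed_segment x p = K \<inter> {x. g \<bullet> x = b}"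
    using xp exposed_face_of_polyhedron[OF polytope_imp_polyhedron[OF K], of "closed_segment x p"]
    unfolding exposed_face_of_def skeleton_def edge_of_def by auto
  have g: "g \<bullet> x = b" "g \<bullet> p = b"
    using gb(2) by (metis Int_Collect ends_in_segment(1), metis Int_Collect ends_in_segment(2))
  have "(\<Sum>e\<in>E. f (e - x) * (b - g \<bullet> e)) = - (g \<bullet> (\<Sum>e\<in>E. f (e - x) *\<^sub>R (e - x)))"
    by (simp add: inner_sum_right inner_diff_right g right_diff_distrib flip: sum_negf)
  also have "\<dots> = 0"
    using px g by (simp add: inner_diff_right flip: px)
  finally have "(\<Sum>e\<in>E. f (e - x) * (b - g \<bullet> e)) = 0" .
  moreover have "f (e - x) * (b - g \<bullet> e) \<ge> 0" if "e \<in> E" for e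
    using f_nonneg[OF that] gb(1) EK that by (intro mult_nonneg_nonneg) auto
  ultimately have "f (e - x) * (b - g \<bullet> e) = 0"
    using sum_nonneg_eq_0_iff[OF E(1), of "\<lambda>e. f (e - x) * (b - g \<bullet> e)"] e(1) by simp
  then have "e \<in> closed_segment x p"
    using e gb(2) EK by auto
  then have "e = x \<or> e = p"
    using vertex_in_skeleton_edge[OF xp] E(2) e(1) by blast
  moreover have "e \<noteq> x"
    using a(3)[OF e(1)] by auto
  ultimately show ?thesis
    using e(1) by blast
qed

section \<open>Faces spanned by outgoing arcs\<close>

locale oriented_polytope =
  fixes Q :: "'a::euclidean_space set" and \<O> :: "('a \<times> 'a) set"
  assumes polytope: "polytope Q"
    and facial: "facial_orientation Q \<O>"
    and simple: "directionally_simple Q \<O>"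
begin

abbreviation reaches :: "'a \<Rightarrow> 'a \<Rightarrow> bool" (infix \<open>\<preceq>\<close> 50)
  where "x \<preceq> y \<equiv> (x, y) \<in> \<O>\<^sup>*"

lemma orientation: "\<O> \<union> \<O>\<inverse> = skeleton Q" "\<O> \<inter> \<O>\<inverse> = {}"
  and acyclic: "acyclic \<O>"
  using facial by (auto simp: facial_orientation_def is_orientation_def)

lemma arc_skeleton: "(x, y) \<in> \<O> \<Longrightarrow> (x, y) \<in> skeleton Q"
  using orientation(1) by blast

lemma skeleton_arc: "(x, y) \<in> skeleton Q \<Longrightarrow> (x, y) \<in> \<O> \<or> (y, x) \<in> \<O>"
  using orientation(1) by blast

lemma arc_vertices: "(x, y) \<in> \<O> \<Longrightarrow> x \<in> vertices Q \<and> y \<in> vertices Q"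
  using arc_skeleton by (auto simp: skeleton_def)

lemma arc_asym: "(x, y) \<in> \<O> \<Longrightarrow> (y, x) \<notin> \<O>"
  using orientation(2) by blast

lemma arc_neq: "(x, y) \<in> \<O> \<Longrightarrow> x \<noteq> y"
  using arc_asym by blast

lemma finite_arcs: "finite \<O>"
  using arc_vertices finite_vertices[OF polytope]
  by (intro finite_subset[of \<O> "vertices Q \<times> vertices Q"]) auto

lemma finite_out: "finite (\<O> `` {x})"
  using finite_arcs by (rule finite_Image)

lemma wf_arcs: "wf \<O>"
  and wf_arcs_converse: "wf (\<O>\<inverse>)"
  using finite_arcs acyclic finite_acyclic_wf finite_acyclic_wf_converse by blast+

lemma le_antisym: "x \<preceq> y \<Longrightarrow> y \<preceq> x \<Longrightarrow> x = y"
  using acyclic_impl_antisym_rtrancl[OF acyclic] by (auto dest: antisymD)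

lemma le_vertex: "x \<preceq> y \<Longrightarrow> x \<in> vertices Q \<Longrightarrow> y \<in> vertices Q"
  by (induction rule: rtrancl_induct) (auto dest: arc_vertices)

lemma convex_face: "F face_of Q \<Longrightarrow> convex F"
  by (simp add: face_of_def)

lemma polytope_face: "F face_of Q \<Longrightarrow> polytope F"
  using polytope face_of_polytope_polytope by blast

lemma face_subface_eq:
  assumes "F face_of Q" "G face_of Q" "F \<subseteq> G" "aff_dim G \<le> aff_dim F"
  shows "F = G"
  using assms face_of_subset[OF assms(1,3) face_of_imp_subset[OF assms(2)]]
  by (intro face_of_eq_if_aff_dim_le) (auto simp: convex_face)

lemma is_source_face:
  "F face_of Q \<Longrightarrow> is_source \<O> F x \<longleftrightarrow> x \<in> vertices Q \<and> x \<in> F \<and> (\<forall>y\<in>F. (y, x) \<notin> \<O>)"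
  by (auto simp: is_source_def face_orientation_def vertices_face dest: arc_vertices)

lemma is_sink_face:
  "F face_of Q \<Longrightarrow> is_sink \<O> F x \<longleftrightarrow> x \<in> vertices Q \<and> x \<in> F \<and> (\<forall>y\<in>F. (x, y) \<notin> \<O>)"
  by (auto simp: is_sink_def face_orientation_def vertices_face dest: arc_vertices)

lemma ex1_source: "F face_of Q \<Longrightarrow> F \<noteq> {} \<Longrightarrow> \<exists>!x. is_source \<O> F x"
  and ex1_sink: "F face_of Q \<Longrightarrow> F \<noteq> {} \<Longrightarrow> \<exists>!x. is_sink \<O> F x"
  using facial by (simp_all add: facial_orientation_def)

lemma sink_face:
  assumes "F face_of Q" "F \<noteq> {}"
  shows "is_sink \<O> F (sink \<O> F)"
  unfolding sink_def using ex1_sink[OF assms] by (rule theI')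

lemma sink_unique:
  assumes "F face_of Q" "is_sink \<O> F x"
  shows "x = sink \<O> F"
proof -
  have "F \<noteq> {}"
    using assms by (auto simp: is_sink_face)
  then show ?thesis
    using ex1_sink[OF assms(1)] sink_face[OF assms(1)] assms(2) by blast
qed

lemma source_unique:
  assumes "F face_of Q" "is_source \<O> F x" "is_source \<O> F y"
  shows "x = y"
proof -
  have "F \<noteq> {}"
    using assms by (auto simp: is_source_face)
  then show ?thesis
    using ex1_source[OF assms(1)] assms(2,3) by blast
qed

text \<open>Arcs inside \<open>F\<close> can be followed from \<open>x\<close> until none leaves;
  finiteness and acyclicity end the walk, and it can only end at the unique sink.\<close>

lemma le_sink:
  assumes "F face_of Q" "x \<in> vertices Q" "x \<in> F"
  shows "x \<preceq> sink \<O> F"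
  using assms(2,3)
proof (induction x rule: wf_induct_rule[OF wf_arcs_converse])
  case (1 x)
  show ?case
  proof (cases "is_sink \<O> F x")
    case True
    then show ?thesis
      using sink_unique[OF assms(1)] by blast
  next
    case False
    then obtain y where y: "y \<in> F" "(x, y) \<in> \<O>"
      using 1 by (auto simp: is_sink_face[OF assms(1)])
    then have "y \<preceq> sink \<O> F"
      using 1(1) arc_vertices by blast
    then show ?thesis
      using y by (simp add: converse_rtrancl_into_rtrancl)
  qed
qed

lemma source_le:
  assumes "F face_of Q" "is_source \<O> F s" "x \<in> vertices Q" "x \<in> F"
  shows "s \<preceq> x"
  using assms(3,4)
proof (induction x rule: wf_induct_rule[OF wf_arcs])
  case (1 x)
  show ?case
  proof (cases "is_source \<O> F x")
    case True
    then show ?thesis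
      using source_unique[OF assms(1,2)] by blast
  next
    case False
    then obtain y where y: "y \<in> F" "(y, x) \<in> \<O>"
      using 1 by (auto simp: is_source_face[OF assms(1)])
    then have "s \<preceq> y"
      using 1(1) arc_vertices by blast
    then show ?thesis
      using y by (simp add: rtrancl_into_rtrancl)
  qed
qed

text \<open>The face whose sink is the pseudojoin, named by heads of arcs at \<open>x\<close>.
  Existence and uniqueness behind \<open>THE\<close> come with
  \<open>out_face_props\<close>.\<close>

definition out_face :: "'a \<Rightarrow> 'a set \<Rightarrow> 'a set"
  where "out_face x N = (THE F. F face_of Q \<and> aff_dim F = int (card N) \<and> x \<in> F \<and> N \<subseteq> F)"

lemma pseudojoin_eq: "pseudojoin Q \<O> x N = sink \<O> (out_face x N)"
  by (simp add: pseudojoin_def out_face_def)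

text \<open>Passes from sets of arcs at \<open>x\<close> to sets of their heads, the form used by
  \<open>pseudojoin\<close>; injectivity of \<open>Pair x\<close> keeps cardinality and
  distinctness.\<close>

lemma directional_faces:
  assumes "x \<in> vertices Q"
  obtains \<Phi> where "inj_on \<Phi> (Pow (\<O> `` {x}))"
    "\<And>N. N \<subseteq> \<O> `` {x} \<Longrightarrow>
      \<Phi> N face_of Q \<and> aff_dim (\<Phi> N) = int (card N) \<and> x \<in> \<Phi> N \<and> N \<subseteq> \<Phi> N"
proof -
  obtain F where F: "inj_on F (Pow (out_edges \<O> x))"
    "\<And>E. E \<subseteq> out_edges \<O> x \<Longrightarrow> F E face_of Q \<and> aff_dim (F E) = int (card E) \<and> x \<in> F E \<and>
      (\<forall>(y, z) \<in> E. closed_segment y z \<subseteq> F E)"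
    using simple assms unfolding directionally_simple_def by blast
  have out: "Pair x ` N \<subseteq> out_edges \<O> x" if "N \<subseteq> \<O> `` {x}" for N
    using that by (auto simp: out_edges_def)
  show thesis
  proof
    show "inj_on (\<lambda>N. F (Pair x ` N)) (Pow (\<O> `` {x}))"
    proof (rule inj_onI)
      fix M N
      assume "M \<in> Pow (\<O> `` {x})" "N \<in> Pow (\<O> `` {x})" "F (Pair x ` M) = F (Pair x ` N)"
      then have "Pair x ` M = Pair x ` N"
        using out by (intro inj_onD[OF F(1)]) auto
      then show "M = N"
        by (simp add: inj_image_eq_iff inj_on_def)
    qed
  next
    fix N
    assume "N \<subseteq> \<O> `` {x}"
    then show "F (Pair x ` N) face_of Q \<and> aff_dim (F (Pair x ` N)) = int (card N)
        \<and> x \<in> F (Pair x ` N) \<and> N \<subseteq> F (Pair x ` N)"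
      using F(2)[OF out[of N]] by (auto simp: card_image inj_on_def)
  qed
qed

text \<open>
  A smaller face would coincide with \<open>F\<^sub>E\<close> for each set \<open>E\<close> obtained from \<open>N\<close> by removing one element,
  against the distinctness of these faces.
\<close>

lemma card_out_le_aff_dim:
  assumes "x \<in> vertices Q" "N \<subseteq> \<O> `` {x}" "K face_of Q" "x \<in> K" "N \<subseteq> K"
  shows "int (card N) \<le> aff_dim K"
  using assms(2-5)
proof (induction "card N" arbitrary: N K rule: less_induct)
  case less
  obtain \<Phi> where inj: "inj_on \<Phi> (Pow (\<O> `` {x}))"
    and \<Phi>: "\<And>N. N \<subseteq> \<O> `` {x} \<Longrightarrow>
      \<Phi> N face_of Q \<and> aff_dim (\<Phi> N) = int (card N) \<and> x \<in> \<Phi> N \<and> N \<subseteq> \<Phi> N"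
    by (rule directional_faces[OF assms(1)]) blast
  have fin: "finite N"
    using less.prems(1) finite_out finite_subset by blast
  show ?case
  proof (rule ccontr)
    assume small: "\<not> ?thesis"
    have K_eq: "K = \<Phi> (N - {e})" if e: "e \<in> N" for e
    proof -
      have N': "N - {e} \<subseteq> \<O> `` {x}" "card (N - {e}) < card N"
        using less.prems(1) card_Diff1_less[OF fin e] by auto
      have card: "int (card (N - {e})) = int (card N) - 1"
        using card.remove[OF fin e] by linarith
      let ?I = "K \<inter> \<Phi> (N - {e})"
      have I: "?I face_of Q"
        using \<Phi>[OF N'(1)] less.prems(2) face_of_Int by blast
      have dim: "int (card (N - {e})) \<le> aff_dim ?I"
        using less.hyps[OF N'(2,1) I] \<Phi>[OF N'(1)] less.prems by blast
      \<comment> \<open>Having at least the dimension of both faces, the intersection is a proper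
        face of neither.\<close>
      have "?I = K"
        by (rule face_subface_eq[OF I less.prems(2)]) (use dim small card in auto)
      moreover have "?I = \<Phi> (N - {e})"
        by (rule face_subface_eq[OF I]) (use \<Phi>[OF N'(1)] dim in auto)
      ultimately show ?thesis
        by simp
    qed
    have "aff_dim K \<ge> 0"
      using less.prems(3) aff_dim_subset[of "{x}" K] by simp
    then have "N \<noteq> {}"
      using small by auto
    then obtain e where e: "e \<in> N"
      by blast
    show False
    \<comment> \<open>A single arc leaves no two sets to compare, but then \<open>K\<close> contains
      the distinct points \<open>x\<close> and \<open>e\<close> and has dimension at least
      1.\<close>
    proof (cases "N = {e}")
      case True
      have "x \<noteq> e"
        using e less.prems(1) arc_neq by blast
      then show False
        using small True less.prems(3,4) aff_dim_subset[of "{x, e}" K] by (simp add: aff_dim_2)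
    next
      case False
      then obtain e' where e': "e' \<in> N" "e' \<noteq> e"
        using e by blast
      have "\<Phi> (N - {e}) = \<Phi> (N - {e'})"
        using K_eq[OF e, symmetric] K_eq[OF e'(1)] by (rule trans)
      then have "N - {e} = N - {e'}"
        by (rule inj_onD[OF inj]) (use less.prems(1) in auto)
      then show False
        using e e' by blast
    qed
  qed
qed

text \<open>The intersection of such a face with \<open>K\<close> still contains \<open>x\<close>
  and \<open>N\<close>, so by \<open>card_out_le_aff_dim\<close> it is not a proper subface. Being
  least makes the face unique.\<close>

lemma out_face_props:
  assumes "x \<in> vertices Q" "N \<subseteq> \<O> `` {x}"
  shows "out_face x N face_of Q" "aff_dim (out_face x N) = int (card N)"
    "x \<in> out_face x N" "N \<subseteq> out_face x N"
    and out_face_least: "\<And>K. K face_of Q \<Longrightarrow> x \<in> K \<Longrightarrow> N \<subseteq> K \<Longrightarrow> out_face x N \<subseteq> K"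
proof -
  let ?P = "\<lambda>F. F face_of Q \<and> aff_dim F = int (card N) \<and> x \<in> F \<and> N \<subseteq> F"
  obtain F where F: "?P F"
    by (rule directional_faces[OF assms(1)]) (use assms(2) in blast)
  have least: "F \<subseteq> K" if K: "K face_of Q" "x \<in> K" "N \<subseteq> K" for K
  proof -
    have I: "F \<inter> K face_of Q"
      using F K face_of_Int by blast
    have "F \<inter> K = F"
      using card_out_le_aff_dim[OF assms I] F K I by (intro face_subface_eq) auto
    then show ?thesis
      by blast
  qed
  have "out_face x N = F"
    unfolding out_face_def
  proof (rule the_equality)
    show "?P F"
      by (rule F)
  next
    fix K
    assume "?P K"
    then show "K = F"
      using least[of K] F face_subface_eq[of F K] by auto
  qed
  then show "out_face x N face_of Q" "aff_dim (out_face x N) = int (card N)"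
    "x \<in> out_face x N" "N \<subseteq> out_face x N"
    "\<And>K. K face_of Q \<Longrightarrow> x \<in> K \<Longrightarrow> N \<subseteq> K \<Longrightarrow> out_face x N \<subseteq> K"
    using F least by auto
qed

lemma out_face_eqI:
  assumes "N \<subseteq> \<O> `` {x}" "K face_of Q" "x \<in> vertices Q" "x \<in> K" "N \<subseteq> K"
    "aff_dim K \<le> int (card N)"
  shows "out_face x N = K"
  using assms out_face_props[OF assms(3,1)] out_face_least[OF assms(3,1), of K]
  by (intro face_subface_eq) auto

text \<open>One more arc would push the dimension above \<open>card N\<close> by
  \<open>card_out_le_aff_dim\<close>.\<close>

lemma out_face_out_neighbour:
  assumes "x \<in> vertices Q" "N \<subseteq> \<O> `` {x}" "(x, y) \<in> \<O>" "y \<in> out_face x N"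
  shows "y \<in> N"
proof (rule ccontr)
  assume "y \<notin> N"
  have "int (card (insert y N)) \<le> aff_dim (out_face x N)"
    using assms out_face_props(1,3,4)[OF assms(1,2)] by (intro card_out_le_aff_dim[of x]) auto
  then show False
    using \<open>y \<notin> N\<close> finite_subset[OF assms(2) finite_out] out_face_props(2)[OF assms(1,2)] by simp
qed

text \<open>The faces spanned by the sets \<open>N - {e}\<close> meet the requirements of
  \<open>edges_at_simple_vertex\<close>, so every edge of the face at \<open>x\<close> leads to
  \<open>N\<close> and is directed outward.\<close>

lemma out_face_source:
  assumes x: "x \<in> vertices Q" and N: "N \<subseteq> \<O> `` {x}"
  shows "is_source \<O> (out_face x N) x"
proof -
  note F = out_face_props[OF x N]
  have "(p, x) \<notin> \<O>" if p: "p \<in> out_face x N" for p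
  proof
    assume px: "(p, x) \<in> \<O>"
    have "p \<in> N"
    proof (rule edges_at_simple_vertex)
      show "polytope (out_face x N)"
        using F(1) polytope_face by blast
      show "(x, p) \<in> skeleton (out_face x N)"
        using skeleton_edge_subset_face[OF F(1)] px p F(3) arc_skeleton skeleton_sym by blast
      show "finite N"
        using N finite_out finite_subset by blast
      show "N \<subseteq> vertices (out_face x N)"
        using F(4) N arc_vertices by (auto simp: vertices_face[OF F(1)])
      show "aff_dim (out_face x N) = int (card N)"
        by (rule F(2))
      show "\<exists>H. H face_of out_face x N \<and> x \<in> H \<and> N - {e} \<subseteq> H \<and> e \<notin> H" if "e \<in> N" for e
      proof (intro exI conjI)
        have N': "N - {e} \<subseteq> \<O> `` {x}"
          using N by blast
        note F' = out_face_props[OF x N']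
        show "x \<in> out_face x (N - {e})" "N - {e} \<subseteq> out_face x (N - {e})"
          using F' by auto
        have "out_face x (N - {e}) \<subseteq> out_face x N"
          using F by (intro out_face_least[OF x N']) auto
        then show "out_face x (N - {e}) face_of out_face x N"
          using face_of_face[OF F(1)] F'(1) by blast
        show "e \<notin> out_face x (N - {e})"
          using out_face_out_neighbour[OF x N'] that N by blast
      qed
    qed
    then show False
      using N px arc_asym by blast
  qed
  then show ?thesis
    using F x by (auto simp: is_source_face)
qed

text \<open>A converse of \<open>out_face_source\<close>. At a source all edges of \<open>H\<close>
  point outward, so \<open>aff_dim_le_vertex_neighbours\<close> bounds the dimension from above by
  \<open>card N\<close>; \<open>card_out_le_aff_dim\<close> is the opposite bound.\<close>

lemma source_face_eq_out_face:
  assumes H: "H face_of Q" and s: "is_source \<O> H x"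
  defines "N \<equiv> \<O> `` {x} \<inter> H"
  shows "aff_dim H = int (card N)" "out_face x N = H"
proof -
  have x: "x \<in> vertices Q" "x \<in> H" "\<And>y. y \<in> H \<Longrightarrow> (y, x) \<notin> \<O>"
    using s by (auto simp: is_source_face[OF H])
  have fin: "finite N"
    unfolding N_def using finite_out by blast
  have "y \<in> N" if "(x, y) \<in> skeleton H" for y
  proof -
    have "y \<in> H" "(x, y) \<in> skeleton Q"
      using that vertices_subset by (auto simp: skeleton_face[OF H])
    then show ?thesis
      using skeleton_arc x(3) by (auto simp: N_def)
  qed
  then have "skeleton H `` {x} \<subseteq> N"
    by blast
  then have "aff_dim (insert x (skeleton H `` {x})) \<le> aff_dim (insert x N)"
    by (intro aff_dim_subset) auto
  moreover have "aff_dim H \<le> aff_dim (insert x (skeleton H `` {x}))"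
    using x polytope_face[OF H] by (intro aff_dim_le_vertex_neighbours) (auto simp: vertices_face[OF H])
  moreover have "aff_dim (insert x N) \<le> int (card N)"
  proof -
    have "x \<notin> N"
      using arc_neq by (auto simp: N_def)
    then show ?thesis
      using aff_dim_le_card[of "insert x N"] fin by simp
  qed
  moreover have "int (card N) \<le> aff_dim H"
    using x H by (intro card_out_le_aff_dim[of x]) (auto simp: N_def)
  ultimately show dim: "aff_dim H = int (card N)"
    by linarith
  show "out_face x N = H"
    using x H dim by (intro out_face_eqI) (auto simp: N_def)
qed

text \<open>
  In a minimal face containing the arc in which \<open>x\<close> is not the source, every facet through the arc has
  \<open>x\<close> as its source. If the dimension is at least three, two such facets provide enough arcs out of
  \<open>x\<close> to make the face an \<open>out_face\<close>, whose source is \<open>x\<close>.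
\<close>

lemma non_source_two_face:
  assumes F: "F face_of Q" and x: "x \<in> F" "x' \<in> F" "(x, x') \<in> \<O>" and s: "\<not> is_source \<O> F x"
  obtains G where "G face_of Q" "G \<subseteq> F" "x \<in> G" "x' \<in> G" "aff_dim G = 2" "\<not> is_source \<O> G x"
proof -
  define P where "P K \<longleftrightarrow> K face_of Q \<and> K \<subseteq> F \<and> x \<in> K \<and> x' \<in> K \<and> \<not> is_source \<O> K x" for K
  have "P F"
    using F x s by (simp add: P_def)
  then obtain K where "P K" and min: "\<And>K'. P K' \<Longrightarrow> nat (aff_dim K) \<le> nat (aff_dim K')"
    using ex_has_least_nat[of P F "\<lambda>K. nat (aff_dim K)"] by blast
  then have K: "K face_of Q" "K \<subseteq> F" "x \<in> K" "x' \<in> K" "\<not> is_source \<O> K x"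
    by (auto simp: P_def)
  have xQ: "x \<in> vertices Q"
    using x arc_vertices by blast
  obtain p where p: "p \<in> K" "(p, x) \<in> \<O>"
    using K xQ by (auto simp: is_source_face)
  have edge: "closed_segment x x' face_of Q" "aff_dim (closed_segment x x') = 1"
    using arc_skeleton[OF x(3)] by (auto simp: skeleton_def edge_of_def)
  have sub: "closed_segment x x' \<subseteq> K"
    using K convex_face closed_segment_subset by blast
  have edge_K: "closed_segment x x' face_of K"
    using face_of_face[OF K(1)] edge(1) sub by blast
  \<comment> \<open>\<open>K\<close> is more than the edge: the arc from \<open>p\<close> enters
    \<open>x\<close> while the arc to \<open>x'\<close> leaves it, so \<open>p\<close> is a third
    vertex.\<close>
  have "aff_dim K \<ge> 2"
  proof (rule ccontr)
    assume "\<not> ?thesis"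
    then have "closed_segment x x' = K"
      using edge K sub by (intro face_subface_eq) auto
    then have "p = x \<or> p = x'"
      using vertex_in_skeleton_edge[OF arc_skeleton[OF x(3)], of p] p arc_vertices by blast
    then show False
      using p(2) x(3) arc_asym by blast
  qed
  moreover have "\<not> aff_dim K \<ge> 3"
  proof
    assume K3: "aff_dim K \<ge> 3"
    obtain H1 H2 where H: "H1 facet_of K" "H2 facet_of K" "closed_segment x x' \<subseteq> H1"
      "closed_segment x x' \<subseteq> H2" "H1 \<noteq> H2"
      using two_facets_containing_face[OF polytope_face[OF K(1)] edge_K] K3 edge(2) by auto
    have facet: "H face_of Q \<and> x \<in> H \<and> H \<subseteq> K \<and> aff_dim K - 1 = int (card (\<O> `` {x} \<inter> H))
        \<and> out_face x (\<O> `` {x} \<inter> H) = H"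
      if "H facet_of K" "closed_segment x x' \<subseteq> H" for H
    proof -
      have HK: "H face_of K" "aff_dim H = aff_dim K - 1"
        using that by (auto simp: facet_of_def)
      have HQ: "H face_of Q" "H \<subseteq> K"
        using HK(1) K(1) face_of_trans face_of_imp_subset by blast+
      have xH: "x \<in> H" "x' \<in> H"
        using that(2) by auto
      have "is_source \<O> H x"
      proof (rule ccontr)
        assume "\<not> is_source \<O> H x"
        then have "P H"
          using HQ xH K(2) by (auto simp: P_def)
        then show False
          using min[of H] HK(2) K3 by linarith
      qed
      then show ?thesis
        using source_face_eq_out_face[OF HQ(1)] HQ xH HK(2) by auto
    qed
    define N1 where "N1 = \<O> `` {x} \<inter> H1"
    define N2 where "N2 = \<O> `` {x} \<inter> H2"
    have N1: "out_face x N1 = H1" "aff_dim K - 1 = int (card N1)" "H1 \<subseteq> K"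
      and N2: "out_face x N2 = H2" "aff_dim K - 1 = int (card N2)" "H2 \<subseteq> K"
      using facet[OF H(1,3)] facet[OF H(2,4)] unfolding N1_def N2_def by blast+
    define N where "N = N1 \<union> N2"
    have N: "N \<subseteq> \<O> `` {x}" "N \<subseteq> K"
      using N1(3) N2(3) by (auto simp: N_def N1_def N2_def)
    have fin: "finite N1" "finite N2"
      using finite_out by (auto simp: N1_def N2_def)
    \<comment> \<open>Distinct facets come from distinct sets of equal size, so the union has at
      least \<open>aff_dim K\<close> elements.\<close>
    have "N1 \<noteq> N2"
      using N1(1) N2(1) H(5) by blast
    moreover have "card N1 = card N2"
      using N1(2) N2(2) by simp
    ultimately have "N1 \<subset> N"
      using fin card_subset_eq[of N1 N2] by (auto simp: N_def)
    then have "card N1 < card N"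
      using fin by (intro psubset_card_mono) (auto simp: N_def)
    then have "out_face x N = K"
      using N K xQ N1(2) by (intro out_face_eqI) auto
    then show False
      using out_face_source[OF xQ N(1)] K(5) by simp
  qed
  ultimately have "aff_dim K = 2"
    by linarith
  then show thesis
    using K that by blast
qed

end

section \<open>Joins and pseudojoins\<close>

text \<open>The Hasse condition enters as \<open>covers\<close>: upper covers of one point form an
  antichain. In \<open>join_exists\<close> the bound \<open>v\<close> ranges over the whole space,
  which matches the lattice since by \<open>le_vertex\<close> only vertices are reachable from
  vertices.\<close>

locale oriented_lattice_polytope = oriented_polytope +
  assumes covers: "\<And>x b c. (x, b) \<in> \<O> \<Longrightarrow> (x, c) \<in> \<O> \<Longrightarrow> b \<preceq> c \<Longrightarrow> b = c"
    and join_exists: "\<And>b c. b \<in> vertices Q \<Longrightarrow> c \<in> vertices Q \<Longrightarrow>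
      \<exists>j. b \<preceq> j \<and> c \<preceq> j \<and> (\<forall>v. b \<preceq> v \<longrightarrow> c \<preceq> v \<longrightarrow> j \<preceq> v)"
begin

text \<open>
  If an upper cover \<open>b\<close> of \<open>y\<close> below the sink were outside \<open>F\<close>, the polygon spanned by \<open>b\<close> and an
  arc of \<open>F\<close> at \<open>y\<close> would have its sink in \<open>F\<close>, hence three vertices in \<open>F\<close>, and so lie in \<open>F\<close>.
\<close>

lemma interval_subset_face:
  assumes F: "F face_of Q" and y: "y \<in> vertices Q" "y \<in> F"
    and le: "y \<preceq> z" "z \<preceq> sink \<O> F"
    and two: "\<And>x b c. \<lbrakk>y \<preceq> x; (x, b) \<in> \<O>; (x, c) \<in> \<O>; b \<noteq> c; b \<preceq> sink \<O> F; c \<preceq> sink \<O> F\<rbrakk>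
      \<Longrightarrow> sink \<O> (out_face x {b, c}) \<preceq> sink \<O> F"
  shows "z \<in> F"
  using y le two
\<comment> \<open>\<open>two\<close> goes into the induction: it speaks only of points above
  \<open>y\<close>, so it passes on to every point above \<open>y\<close>.\<close>
proof (induction y arbitrary: z rule: wf_induct_rule[OF wf_arcs_converse])
  case (1 y)
  let ?t = "sink \<O> F"
  have IH: "z \<in> F" if "(y, y') \<in> \<O>" "y' \<in> F" "y' \<preceq> z" "z \<preceq> ?t" for y' z
    using 1(1)[of y' z] that 1(6) arc_vertices by (simp add: converse_rtrancl_into_rtrancl)
  show ?case
  proof (cases "z = y")
    case True
    then show ?thesis
      using 1 by simp
  next
    case False
    then obtain b where b: "(y, b) \<in> \<O>" "b \<preceq> z"
      using \<open>y \<preceq> z\<close> by (metis converse_rtranclE)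
    have "y \<noteq> ?t"
      using False 1(4,5) le_antisym by blast
    then obtain y' where y': "y' \<in> F" "(y, y') \<in> \<O>"
      using sink_unique[OF F, of y] 1(2,3) by (auto simp: is_sink_face[OF F])
    have "b \<in> F"
    proof (cases "b = y'")
      case False
      define G where "G = out_face y {b, y'}"
      have sub: "{b, y'} \<subseteq> \<O> `` {y}"
        using b y' by auto
      note G = out_face_props[OF 1(2) sub, folded G_def]
      have G_sink: "is_sink \<O> G (sink \<O> G)"
        using G by (intro sink_face) auto
      have "y' \<preceq> sink \<O> G"
        using le_sink[OF G(1)] G(4) y' arc_vertices by blast
      moreover have "sink \<O> G \<preceq> ?t"
        unfolding G_def
      proof (rule 1(6))
        show "b \<preceq> ?t"
          using b(2) 1(5) by (rule rtrancl_trans)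
        show "y' \<preceq> ?t"
          using le_sink[OF F] y' arc_vertices by blast
      qed (use b y' False in auto)
      \<comment> \<open>The sink of \<open>G\<close> lies between \<open>y'\<close> and the sink of
        \<open>F\<close>, so the induction hypothesis at \<open>y'\<close> applies.\<close>
      ultimately have in_F: "sink \<O> G \<in> F"
        using IH y' by blast
      have "sink \<O> G \<noteq> y"
        using G_sink y'(2) G(4) by (auto simp: is_sink_face[OF G(1)])
      moreover have "sink \<O> G \<noteq> y'"
      proof
        assume eq: "sink \<O> G = y'"
        have "b \<preceq> y'"
          using le_sink[OF G(1), of b] G(4) b arc_vertices eq by auto
        then show False
          using covers b(1) y'(2) False by blast
      qed
      moreover have I: "F \<inter> G face_of Q"
        using F G(1) face_of_Int by blast
      have edge: "closed_segment y y' face_of Q" "aff_dim (closed_segment y y') = 1"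
        using arc_skeleton[OF y'(2)] by (auto simp: skeleton_def edge_of_def)
      have sub_I: "closed_segment y y' \<subseteq> F \<inter> G"
        using 1(3) y' G convex_face[OF I] by (intro closed_segment_subset) auto
      ultimately have "\<not> aff_dim (F \<inter> G) \<le> 1"
        using vertex_in_skeleton_edge[OF arc_skeleton[OF y'(2)], of "sink \<O> G"] G_sink in_F
          face_subface_eq[OF edge(1) I sub_I] edge(2)
        by (auto simp: is_sink_face[OF G(1)])
      then have "F \<inter> G = G"
        using I G(1,2) False by (intro face_subface_eq) auto
      then show "b \<in> F"
        using G(4) by blast
    qed (use y' in simp)
    then show ?thesis
      using IH[OF b(1) _ b(2)] 1(5) by blast
  qed
qed


text \<open>
  By \<open>interval_subset_face\<close> the join \<open>j\<close> of \<open>b\<close> and \<open>c\<close> lies on the polygon, where it is entered by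
  two different arcs. As a vertex of a polygon has only two edges, \<open>j\<close> is the sink.
\<close>

lemma pseudojoin_two_le:
  assumes "(x, b) \<in> \<O>" "(x, c) \<in> \<O>" "b \<noteq> c" "b \<preceq> v" "c \<preceq> v"
  shows "sink \<O> (out_face x {b, c}) \<preceq> v"
  using assms
\<comment> \<open>The transitive closure is taken because the claim is needed at all points strictly
  above \<open>x\<close>, not only at heads of arcs from \<open>x\<close>.\<close>
proof (induction x arbitrary: b c v rule: wf_induct_rule[OF wf_trancl[OF wf_arcs_converse]])
  case (1 x)
  define F where "F = out_face x {b, c}"
  define t where "t = sink \<O> F"
  have x: "x \<in> vertices Q" and b: "b \<in> vertices Q" and c: "c \<in> vertices Q"
    using 1(2,3) arc_vertices by auto
  have sub: "{b, c} \<subseteq> \<O> `` {x}"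
    using 1(2,3) by auto
  note F = out_face_props(1-4)[OF x sub, folded F_def]
  have le_t: "b \<preceq> t" "c \<preceq> t"
    using le_sink[OF F(1)] b c F(4) by (auto simp: t_def)
  obtain j where j: "b \<preceq> j" "c \<preceq> j" and j_least: "\<And>v. b \<preceq> v \<Longrightarrow> c \<preceq> v \<Longrightarrow> j \<preceq> v"
    using join_exists[OF b c] by blast
  \<comment> \<open>The interval starts at \<open>d\<close> rather than at \<open>x\<close>, so
    \<open>two\<close> is required only strictly above \<open>x\<close>, where the induction
    hypothesis supplies it.\<close>
  have in_F: "z \<in> F" if d: "(x, d) \<in> \<O>" "d \<in> F" and z: "d \<preceq> z" "z \<preceq> t" for d z
  proof (rule interval_subset_face[OF F(1) _ d(2) z(1) z(2)[unfolded t_def]])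
    show "d \<in> vertices Q"
      using d(1) arc_vertices by blast
    fix y b' c'
    assume y: "d \<preceq> y" and "(y, b') \<in> \<O>" "(y, c') \<in> \<O>" "b' \<noteq> c'"
      "b' \<preceq> sink \<O> F" "c' \<preceq> sink \<O> F"
    moreover have "(x, y) \<in> \<O>\<^sup>+"
      using d(1) y by (rule rtrancl_into_trancl2)
    ultimately show "sink \<O> (out_face y {b', c'}) \<preceq> sink \<O> F"
      by (intro 1(1)) (simp_all add: trancl_converse)
  qed
  have "j \<preceq> t"
    using j_least le_t by blast
  then have jF: "j \<in> F"
    using in_F[OF 1(2)] F(4) j(1) by blast
  have jQ: "j \<in> vertices Q"
    using le_vertex j(1) b by blast
  have "b \<noteq> j"
    using covers[OF 1(3,2)] 1(4) j(2) by auto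
  with j(1) obtain p where p: "b \<preceq> p" "(p, j) \<in> \<O>"
    by (auto elim: rtranclE)
  have "c \<noteq> j"
    using covers[OF 1(2,3)] 1(4) j(1) by auto
  with j(2) obtain q where q: "c \<preceq> q" "(q, j) \<in> \<O>"
    by (auto elim: rtranclE)
  have "p \<preceq> t" "q \<preceq> t"
    using p(2) q(2) \<open>j \<preceq> t\<close> by (auto intro: converse_rtrancl_into_rtrancl)
  then have pqF: "p \<in> F" "q \<in> F"
    using in_F 1(2,3) F(4) p(1) q(1) by blast+
  \<comment> \<open>Otherwise \<open>p\<close> would be a common upper bound of \<open>b\<close> and
    \<open>c\<close> strictly below their join.\<close>
  have "p \<noteq> q"
  proof
    assume "p = q"
    then have "j \<preceq> p"
      using j_least p(1) q(1) by blast
    moreover have "p \<preceq> j"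
      using p(2) by blast
    ultimately show False
      using le_antisym p(2) arc_neq by blast
  qed
  have "is_sink \<O> F j"
  proof (rule ccontr)
    assume "\<not> is_sink \<O> F j"
    then obtain k where k: "k \<in> F" "(j, k) \<in> \<O>"
      using jF jQ by (auto simp: is_sink_face[OF F(1)])
    have edge: "(j, p) \<in> skeleton Q" "(j, q) \<in> skeleton Q"
      using p(2) q(2) arc_skeleton skeleton_sym by blast+
    \<comment> \<open>The edges from \<open>j\<close> to \<open>p\<close> and to \<open>q\<close>
      serve as the faces omitting \<open>q\<close> and \<open>p\<close>, so the polygon has no third
      edge at \<open>j\<close>.\<close>
    have "k \<in> {p, q}"
    proof (rule edges_at_simple_vertex)
      show "polytope F"
        using F(1) polytope_face by blast
      show "(j, k) \<in> skeleton F"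
        using skeleton_edge_subset_face[OF F(1)] k jF arc_skeleton by blast
      show "{p, q} \<subseteq> vertices F"
        using pqF p(2) q(2) arc_vertices by (auto simp: vertices_face[OF F(1)])
      show "aff_dim F = int (card {p, q})"
        using F(2) \<open>p \<noteq> q\<close> \<open>b \<noteq> c\<close> by simp
      have seg: "closed_segment j y face_of F \<and> z \<notin> closed_segment j y"
        if "(j, y) \<in> skeleton Q" "y \<in> F" "(z, j) \<in> \<O>" "z \<noteq> y" for y z
      proof
        show "closed_segment j y face_of F"
          using skeleton_edge_subset_face[OF F(1)] that jF by (auto simp: skeleton_def edge_of_def)
        show "z \<notin> closed_segment j y"
          using vertex_in_skeleton_edge[OF that(1), of z] that(3,4) arc_vertices arc_neq by blast
      qed
      show "\<exists>H. H face_of F \<and> j \<in> H \<and> {p, q} - {e} \<subseteq> H \<and> e \<notin> H" if "e \<in> {p, q}" for e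
      proof (cases "e = p")
        case True
        then show ?thesis
          using seg[OF edge(2) pqF(2) p(2) \<open>p \<noteq> q\<close>]
          by (intro exI[of _ "closed_segment j q"]) auto
      next
        case False
        then show ?thesis
          using that seg[OF edge(1) pqF(1) q(2)] \<open>p \<noteq> q\<close>
          by (intro exI[of _ "closed_segment j p"]) auto
      qed
    qed simp
    then show False
      using k(2) p(2) q(2) arc_asym by blast
  qed
  then have "j = t"
    using sink_unique[OF F(1)] by (simp add: t_def)
  then show ?case
    using j_least 1(5,6) by (simp add: t_def F_def)
qed

lemma pseudojoin_le:
  assumes u: "u \<in> vertices Q" and N: "N \<subseteq> \<O> `` {u}" and uv: "u \<preceq> v"
    and Nv: "\<And>a. a \<in> N \<Longrightarrow> a \<preceq> v"
  shows "sink \<O> (out_face u N) \<preceq> v"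
proof -
  define F where "F = out_face u N"
  note F = out_face_props(1-4)[OF u N, folded F_def]
  \<comment> \<open>The choice of a minimal starting point becomes induction over all points
    strictly below \<open>x\<close>: the source of the polygon may be several arcs away.\<close>
  have stay: "x' \<preceq> v" if "(x, x') \<in> \<O>" "x \<in> F" "x' \<in> F" "x \<preceq> v" for x x'
    using that
  proof (induction x arbitrary: x' rule: wf_induct_rule[OF wf_trancl[OF wf_arcs]])
    case (1 x)
    show ?case
    proof (cases "is_source \<O> F x")
      case True
      then have "x = u"
        using source_unique[OF F(1)] out_face_source[OF u N] by (simp add: F_def)
      then have "x' \<in> N"
        using out_face_out_neighbour[OF u N] 1(2,4) by (simp add: F_def)
      then show ?thesis
        by (rule Nv)
    next
      case False
      obtain G where G: "G face_of Q" "G \<subseteq> F" "x \<in> G" "x' \<in> G" "aff_dim G = 2"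
        "\<not> is_source \<O> G x"
        using non_source_two_face[OF F(1) 1(3,4,2) False] by blast
      obtain s where s: "is_source \<O> G s"
        using ex1_source[OF G(1)] G(3) by blast
      have s': "s \<in> vertices Q" "s \<in> G"
        using s by (auto simp: is_source_face[OF G(1)])
      have x: "x \<in> vertices Q" "x' \<in> vertices Q"
        using 1(2) arc_vertices by auto
      have sx: "s \<preceq> x"
        using source_le[OF G(1) s] x G by blast
      moreover have "s \<noteq> x"
        using s G(6) by blast
      ultimately have sx': "(s, x) \<in> \<O>\<^sup>+"
        by (simp add: rtrancl_eq_or_trancl)
      have sv: "s \<preceq> v"
        using sx 1(5) by (rule rtrancl_trans)
      define M where "M = \<O> `` {s} \<inter> G"
      have M: "card M = 2" "out_face s M = G"
        using source_face_eq_out_face[OF G(1) s] G(5) by (simp_all add: M_def)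
      then obtain b c where bc: "M = {b, c}" "b \<noteq> c"
        by (auto simp: card_2_iff)
      have arcs: "(s, b) \<in> \<O>" "b \<in> G" "(s, c) \<in> \<O>" "c \<in> G"
        using bc(1) by (auto simp: M_def)
      have "b \<preceq> v" "c \<preceq> v"
        using 1(1)[OF sx'] arcs s'(2) G(2) sv by blast+
      then have "sink \<O> G \<preceq> v"
        using pseudojoin_two_le[OF arcs(1,3) bc(2)] M(2) bc(1) by simp
      moreover have "x' \<preceq> sink \<O> G"
        using le_sink[OF G(1)] x G by blast
      ultimately show ?thesis
        by (rule rtrancl_trans[rotated])
    qed
  qed
  \<comment> \<open>On a walk along arcs of \<open>F\<close> that starts below \<open>v\<close>,
    \<open>stay\<close> keeps every point below \<open>v\<close> until the sink is reached;
    \<open>u\<close> is such a start.\<close>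
  have "sink \<O> F \<preceq> v" if "x \<in> vertices Q" "x \<in> F" "x \<preceq> v" for x
    using that
  proof (induction x rule: wf_induct_rule[OF wf_arcs_converse])
    case (1 x)
    show ?case
    proof (cases "is_sink \<O> F x")
      case True
      then show ?thesis
        using sink_unique[OF F(1)] 1 by blast
    next
      case False
      then obtain y where y: "y \<in> F" "(x, y) \<in> \<O>"
        using 1 by (auto simp: is_sink_face[OF F(1)])
      then show ?thesis
        using 1 stay[of x y] arc_vertices by blast
    qed
  qed
  then show ?thesis
    using u F(3) uv by (simp add: F_def)
qed

end

theorem theorem3p4:
  fixes Q :: "'a::euclidean_space set" and \<O> :: "('a \<times> 'a) set"
    and u :: 'a and a :: "nat \<Rightarrow> 'a" and r :: nat
  defines "L \<equiv> skeleton_poset Q \<O>"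
  assumes "polytope Q"
    and "facial_orientation Q \<O>"
    and "directionally_simple Q \<O>"
    and "Lattice.lattice L"
    and "is_Hasse_diagram_of \<O> L"
    and "u \<in> carrier L"
    and "r \<ge> 1"
    and "inj_on a {1..r}"
    and "\<forall>i\<in>{1..r}. is_covered_by L u (a i)"
  shows "\<Squnion>\<^bsub>L\<^esub> (a ` {1..r}) = pseudojoin Q \<O> u (a ` {1..r})"
proof -
  interpret oriented_polytope Q \<O>
    by unfold_locales (fact assms)+
  interpret L: Lattice.lattice L
    by fact
  have L [simp]: "carrier L = vertices Q" "le L x y \<longleftrightarrow> x \<preceq> y" "eq L = (=)" for x y
    by (simp_all add: L_def skeleton_poset_def)
  have arc: "(x, y) \<in> \<O> \<longleftrightarrow> is_covered_by L x y" for x y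
    using assms(6) by (auto simp: is_Hasse_diagram_of_def)
  interpret oriented_lattice_polytope Q \<O>
  proof unfold_locales
    fix x b c
    assume "(x, b) \<in> \<O>" "(x, c) \<in> \<O>" "b \<preceq> c"
    \<comment> \<open>If \<open>b\<close> and \<open>c\<close> differed, \<open>b\<close> would lie
      strictly between \<open>x\<close> and its cover \<open>c\<close>.\<close>
    then show "b = c"
      unfolding arc is_covered_by_def lless_def by auto
  next
    fix b c
    assume bc: "b \<in> vertices Q" "c \<in> vertices Q"
    then obtain j where j: "least L j (Upper L {b, c})"
      using L.sup_of_two_exists[of b c] by auto
    have "j \<preceq> v" if "b \<preceq> v" "c \<preceq> v" for v
      using j that le_vertex[OF that(1) bc(1)] by (auto simp: least_def Upper_def)
    moreover have "b \<preceq> j" "c \<preceq> j"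
      using j bc by (auto simp: least_def Upper_def)
    ultimately show "\<exists>j. b \<preceq> j \<and> c \<preceq> j \<and> (\<forall>v. b \<preceq> v \<longrightarrow> c \<preceq> v \<longrightarrow> j \<preceq> v)"
      by blast
  qed
  let ?N = "a ` {1..r}"
  let ?t = "pseudojoin Q \<O> u ?N"
  have u: "u \<in> vertices Q"
    using assms(7) by simp
  have N: "?N \<subseteq> \<O> `` {u}"
    using assms(10) by (auto simp: arc)
  then have NQ: "?N \<subseteq> vertices Q"
    using arc_vertices by blast
  note F = out_face_props(1-4)[OF u N]
  have t: "is_sink \<O> (out_face u ?N) ?t"
    unfolding pseudojoin_eq using F by (intro sink_face) auto
  have "?t \<in> Upper L ?N"
    using t NQ F le_sink[OF F(1)] by (auto simp: Upper_def is_sink_face pseudojoin_eq)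
  moreover have "?t \<preceq> v" if v: "v \<in> Upper L ?N" for v
    unfolding pseudojoin_eq
  proof (rule pseudojoin_le[OF u N])
    show Nv: "y \<preceq> v" if "y \<in> ?N" for y
      using v that NQ by (auto simp: Upper_def)
    \<comment> \<open>Here \<open>r \<ge> 1\<close> matters: an upper bound of the empty set need
      not lie above \<open>u\<close>.\<close>
    have "a 1 \<in> ?N"
      using assms(8) by auto
    then show "u \<preceq> v"
      using Nv[of "a 1"] N by (auto intro: converse_rtrancl_into_rtrancl)
  qed
  ultimately have "least L ?t (Upper L ?N)"
    by (simp add: least_def Upper_closed[of L, simplified])
  then show ?thesis
    unfolding Lattice.sup_def using L.least_unique by (intro some_equality)
qed

end
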